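(* Let $W$ be ULC($n$) with support $\{0,1,\ldots,n\}$ and mean $nr>0$. Let $Z\sim\mathrm{Bin}(n,r)$. If $W$ has distribution function $F$ and $Z$ has distribution function $G$, then $$d_{-k,\infty}(F,G)\leq2^{(-k)_+-1}\left\{nr(1-r)-\mathrm{Var}(W)\right\}$$ for $k\in\{-1,0,1,2\}$.
   Context: $n\geq1$ is an integer; $(x)_+=\max(x,0)$; $2^{(-k)_+-1}$ means $2$ to the power $(-k)_+-1$. The support of $W$ is the set of $i$ with $\mathbb{P}(W=i)>0$. A random variable $X$ supported on $\{0,1,\ldots,n\}$ is ULC($n$) (ultra log-concave of degree $n$) if $\frac{\mathbb{P}(X=i+1)^2}{\binom{n}{i+1}^2}\geq\frac{\mathbb{P}(X=i)}{\binom{n}{i}}\frac{\mathbb{P}(X=i+2)}{\binom{n}{i+2}}$ for $0\leq i\leq n-2$. Differences: $\Delta f(j)=f(j+1)-f(j)$, $\Delta^{-1}f(j)=-\sum_{i=j}^\infty f(i)$, $\Delta^0f=f$, $\Delta^{-2}f=\Delta^{-1}(\Delta^{-1}f)$. For an integer $m$, $d_{m,\infty}(F,G)=\lVert\Delta^mF-\Delta^mG\rVert_\infty$, where $\lVert f\rVert_\infty=\sup_{j\in\{0,1,2,\ldots\}}|f(j)|$ and $\Delta^mF-\Delta^mG$ means $\Delta^m(F-G)$. *)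

theory Defs
  imports "HOL-Probability.Probability"
begin

text \<open>Random variables with values in the natural numbers are represented by their laws, of type
  \<^typ>\<open>nat pmf\<close>; the support of the law is \<^const>\<open>set_pmf\<close>.\<close>

definition ULC :: "nat \<Rightarrow> nat pmf \<Rightarrow> bool" where
  "ULC n X \<longleftrightarrow> set_pmf X \<subseteq> {0..n} \<and>
     (\<forall>i. i + 2 \<le> n \<longrightarrow>
        (pmf X (i + 1))\<^sup>2 / (real (n choose (i + 1)))\<^sup>2
          \<ge> pmf X i / real (n choose i) * (pmf X (i + 2) / real (n choose (i + 2))))"

definition dist_fun :: "nat pmf \<Rightarrow> nat \<Rightarrow> real" where
  "dist_fun X j = measure_pmf.prob X {..j}"

definition fdiff :: "(nat \<Rightarrow> real) \<Rightarrow> nat \<Rightarrow> real" where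
  "fdiff f j = f (j + 1) - f j"

text \<open>The series over all \<open>i \<ge> j\<close>, reindexed to start at \<open>0\<close>. It is meant for functions with
  summable values; differences of distribution functions of laws on \<open>{0..n}\<close> vanish from \<open>n\<close>
  onwards, so there the series and its iterates have only finitely many nonzero terms.\<close>
definition fdiff_inv :: "(nat \<Rightarrow> real) \<Rightarrow> nat \<Rightarrow> real" where
  "fdiff_inv f j = - (\<Sum>i. f (j + i))"

definition fdiff_pow :: "int \<Rightarrow> (nat \<Rightarrow> real) \<Rightarrow> nat \<Rightarrow> real" where
  "fdiff_pow m f = (if m \<ge> 0 then (fdiff ^^ nat m) f else (fdiff_inv ^^ nat (- m)) f)"

text \<open>The supremum is taken in the extended reals, so it is meaningful also for unbounded
  functions.\<close>
definition sup_norm :: "(nat \<Rightarrow> real) \<Rightarrow> ereal" where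
  "sup_norm f = (SUP j. ereal \<bar>f j\<bar>)"

text \<open>The operator is applied to the difference \<open>F - G\<close>, because for negative \<open>m\<close> the series for
  \<open>F\<close> and \<open>G\<close> separately diverge.\<close>
definition d_inf :: "int \<Rightarrow> (nat \<Rightarrow> real) \<Rightarrow> (nat \<Rightarrow> real) \<Rightarrow> ereal" where
  "d_inf m F G = sup_norm (fdiff_pow m (\<lambda>j. F j - G j))"

end

theory Submission
  imports Defs
begin

text \<open>
  The proof rests on two observations.

  First, \<open>W\<close> is smaller than \<open>Z\<close> in the convex order. Ultra log-concavity of \<open>W\<close> says precisely
  that the likelihood ratio \<open>h i = P(W = i) / P(Z = i)\<close> is log-concave, because the binomial
  weights are \<open>n choose i\<close> times a geometric sequence. Hence \<open>{i. h i \<ge> 1}\<close> is an interval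
  (\<open>ULC_ge_binomial_interval\<close>). If one law exceeds another exactly on an interval, and
  both have the same mean, then the chord of a convex \<open>\<phi>\<close> over that interval lies above \<open>\<phi>\<close> where
  the first law is the heavier and below \<open>\<phi>\<close> where it is the lighter, while the chord itself has
  the same expectation under both; so the expectation of \<open>\<phi>\<close> is smaller for the first law
  (\<open>expectation_convex_le_of_interval\<close>).

  Secondly, the iterated sums of \<open>F - G\<close> are differences of expectations. Put
  \<open>u j = E (Z - j)\<^sub>+ - E (W - j)\<^sub>+\<close> and let \<open>w j\<close> be the same difference for the function
  \<open>i \<mapsto> ((i - j)\<^sub>+ + 1) choose 2\<close>. Then \<open>\<Delta> w = - u\<close> and \<open>\<Delta> (- u) = F - G\<close>, so the inverse
  differences of \<open>F - G\<close> of orders 1 and 2 are \<open>- u\<close> and \<open>w\<close>. Convex order gives \<open>u \<ge> 0\<close>; thus \<open>w\<close>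
  decreases to its final value 0 from
  \<open>w 0 = (E Z (Z + 1) - E W (W + 1)) / 2 = (Var Z - Var W) / 2\<close>. All four bounds follow: the
  values of \<open>w\<close> lie in \<open>[0, w 0]\<close>; the values of \<open>u\<close>, being decrements of \<open>w\<close>, lie there too;
  so the decrements of \<open>u\<close>, which are the values of \<open>F - G\<close>, lie in \<open>[- w 0, w 0]\<close>; and the
  differences of \<open>F - G\<close> are at most \<open>2 * w 0\<close> in absolute value.
\<close>

section \<open>Superlevel sets of log-concave sequences\<close>

text \<open>Log-concavity makes successive ratios decrease, so once such a sequence strictly descends it
  never recovers.\<close>

lemma log_concave_descent_persists:
  fixes h :: "nat \<Rightarrow> real"
  assumes pos: "\<And>i. i \<le> n \<Longrightarrow> h i > 0"
    and lc: "\<And>i. i + 2 \<le> n \<Longrightarrow> h i * h (i + 2) \<le> (h (i + 1))\<^sup>2"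
    and desc: "h (Suc s) < h s"
  shows "s \<le> t \<Longrightarrow> t < n \<Longrightarrow> h (Suc t) < h t"
proof (induction t rule: dec_induct)
  case base
  show ?case by (rule desc)
next
  case (step t)
  have "h t * h (Suc (Suc t)) \<le> h (Suc t) * h (Suc t)"
    using lc[of t] step.prems by (simp add: power2_eq_square)
  also have "\<dots> < h t * h (Suc t)"
    using step pos[of "Suc t"] by (intro mult_strict_right_mono) auto
  finally show ?case
    using pos[of t] step.prems by simp
qed

lemma log_concave_superlevel_interval:
  fixes h :: "nat \<Rightarrow> real"
  assumes pos: "\<And>i. i \<le> n \<Longrightarrow> h i > 0"
    and lc: "\<And>i. i + 2 \<le> n \<Longrightarrow> h i * h (i + 2) \<le> (h (i + 1))\<^sup>2"
    and "i \<le> k" "k \<le> m" "m \<le> n" and hi: "h i \<ge> c" and hm: "h m \<ge> c"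
  shows "h k \<ge> c"
proof (rule ccontr)
  assume less: "\<not> h k \<ge> c"
  have "\<exists>s. i \<le> s \<and> s < k \<and> h (Suc s) < h s"
  proof (rule ccontr)
    assume "\<not> ?thesis"
    then have step: "\<And>s. i \<le> s \<Longrightarrow> s < k \<Longrightarrow> h s \<le> h (Suc s)"
      by (meson not_le)
    have "t \<le> k \<longrightarrow> h i \<le> h t" if "i \<le> t" for t
      using that by (induction t rule: dec_induct) (use step in fastforce)+
    with less hi \<open>i \<le> k\<close> show False
      by fastforce
  qed
  then obtain s where s: "i \<le> s" "s < k" "h (Suc s) < h s"
    by blast
  have desc: "h (Suc t) < h t" if "s \<le> t" "t < n" for t
    using pos lc s(3) that by (rule log_concave_descent_persists)
  have "t \<le> n \<longrightarrow> h t \<le> h k" if "k \<le> t" for t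
    using that
  proof (induction t rule: dec_induct)
    case (step t)
    then show ?case
      using desc[of t] s(2) by fastforce
  qed simp
  with hm less \<open>k \<le> m\<close> \<open>m \<le> n\<close> show False
    by fastforce
qed

text \<open>Dividing the binomial probability by \<open>n choose i\<close> leaves a geometric sequence, for which
  log-concavity is an equality. So the likelihood ratio inherits log-concavity from the normalised
  weights of \<open>W\<close>.\<close>

lemma ULC_ge_binomial_interval:
  assumes ulc: "ULC n W" and supp: "set_pmf W = {0..n}" and r: "0 < r" "r < 1"
    and ikm: "i \<le> k" "k \<le> m" "m \<le> n"
    and i: "pmf W i \<ge> pmf (binomial_pmf n r) i"
    and m: "pmf W m \<ge> pmf (binomial_pmf n r) m"
  shows "pmf W k \<ge> pmf (binomial_pmf n r) k"
proof -
  define b where "b = (\<lambda>i. r ^ i * (1 - r) ^ (n - i))"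
  define a where "a = (\<lambda>i. pmf W i / real (n choose i))"
  have b_pos: "b i > 0" for i
    using r by (simp add: b_def)
  have Z: "pmf (binomial_pmf n r) i = real (n choose i) * b i" for i
    using r by (simp add: b_def)
  have W_pos: "pmf W i > 0" if "i \<le> n" for i
    using supp that by (simp add: pmf_positive)
  have a_pos: "a i > 0" if "i \<le> n" for i
    using W_pos[OF that] that by (simp add: a_def)
  have ge_iff: "pmf W i \<ge> pmf (binomial_pmf n r) i \<longleftrightarrow> a i / b i \<ge> 1" if "i \<le> n" for i
    using b_pos[of i] that by (simp add: Z a_def field_simps)
  have b_geom: "b i * b (i + 2) = (b (i + 1))\<^sup>2" if "i + 2 \<le> n" for i
  proof -
    define l where "l = n - (i + 2)"
    have "n - i = l + 2" "n - (i + 1) = l + 1" "n - (i + 2) = l"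
      using that by (simp_all add: l_def)
    then show ?thesis
      by (simp add: b_def power_add power2_eq_square)
  qed
  have "a k / b k \<ge> 1"
  proof (rule log_concave_superlevel_interval[OF _ _ ikm])
    show "a i / b i > 0" if "i \<le> n" for i
      using a_pos[OF that] b_pos by simp
    show "a i / b i * (a (i + 2) / b (i + 2)) \<le> (a (i + 1) / b (i + 1))\<^sup>2" if "i + 2 \<le> n" for i
    proof -
      have "a i * a (i + 2) \<le> (a (i + 1))\<^sup>2"
        using ulc that unfolding ULC_def a_def power_divide by blast
      then have "a i * a (i + 2) / (b (i + 1))\<^sup>2 \<le> (a (i + 1))\<^sup>2 / (b (i + 1))\<^sup>2"
        by (rule divide_right_mono) simp
      then show ?thesis
        using b_geom[OF that] by (simp add: power_divide)
    qed
    show "a i / b i \<ge> 1" "a m / b m \<ge> 1"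
      using i m ikm ge_iff[of i] ge_iff[of m] by simp_all
  qed
  then show ?thesis
    using ge_iff[of k] ikm by simp
qed

section \<open>Convex order from an interval of excess\<close>

lemma expectation_eq_sum_atMost:
  fixes f :: "nat \<Rightarrow> real"
  assumes "set_pmf P \<subseteq> {..n}"
  shows "measure_pmf.expectation P f = (\<Sum>i\<le>n. f i * pmf P i)"
  using assms by (intro integral_measure_pmf_real) auto

lemma convex_on_positive_part: "convex_on UNIV (\<lambda>x::real. max (x - c) 0)"
proof (rule convex_onI)
  fix t x y :: real
  assume t: "0 < t" "t < 1"
  let ?p = "\<lambda>x. max (x - c) 0"
  have "(1 - t) * (x - c) \<le> (1 - t) * ?p x" "t * (y - c) \<le> t * ?p y"
    using t by (simp_all add: mult_left_mono)
  moreover have "0 \<le> (1 - t) * ?p x" "0 \<le> t * ?p y"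
    using t by simp_all
  moreover have "(1 - t) *\<^sub>R x + t *\<^sub>R y - c = (1 - t) * (x - c) + t * (y - c)"
    by (simp add: algebra_simps)
  ultimately show "?p ((1 - t) *\<^sub>R x + t *\<^sub>R y) \<le> (1 - t) * ?p x + t * ?p y"
    by linarith
qed simp

text \<open>Clearing the denominator in the three-point form of convexity.\<close>

lemma convex_on_three_points:
  fixes \<phi> :: "real \<Rightarrow> real"
  assumes cvx: "convex_on UNIV \<phi>" and "x \<le> y" "y \<le> z"
  shows "(z - x) * \<phi> y \<le> (z - y) * \<phi> x + (y - x) * \<phi> z"
proof (cases "x = z")
  case False
  define t where "t = (y - x) / (z - x)"
  have pos: "z - x > 0"
    using assms False by simp
  have t: "t * (z - x) = y - x" "0 \<le> t" "t \<le> 1"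
    using assms pos by (auto simp: t_def)
  have "(1 - t) *\<^sub>R x + t *\<^sub>R z = y"
    using t(1) by (simp add: algebra_simps)
  then have "\<phi> y \<le> (1 - t) * \<phi> x + t * \<phi> z"
    using convex_onD[OF cvx t(2,3), of x z] by simp
  then have "(z - x) * \<phi> y \<le> (z - x) * ((1 - t) * \<phi> x + t * \<phi> z)"
    using pos by simp
  also have "\<dots> = (z - x - t * (z - x)) * \<phi> x + t * (z - x) * \<phi> z"
    by (simp add: algebra_simps)
  finally show ?thesis
    by (simp add: t(1))
qed (use assms in simp)

text \<open>A form of the crossing criterion of Karlin and Novikoff: compare \<open>\<phi>\<close> with its chord over the
  interval of excess.\<close>

lemma expectation_convex_le_of_interval:
  fixes P Q :: "nat pmf" and \<phi> :: "real \<Rightarrow> real"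
  assumes P: "set_pmf P \<subseteq> {..n}" and Q: "set_pmf Q \<subseteq> {..n}"
    and mean: "measure_pmf.expectation P real = measure_pmf.expectation Q real"
    and interval: "\<And>i k m. i \<le> k \<Longrightarrow> k \<le> m \<Longrightarrow> m \<le> n \<Longrightarrow>
      pmf P i \<ge> pmf Q i \<Longrightarrow> pmf P m \<ge> pmf Q m \<Longrightarrow> pmf P k \<ge> pmf Q k"
    and cvx: "convex_on UNIV \<phi>"
  shows "measure_pmf.expectation P (\<lambda>i. \<phi> (real i)) \<le> measure_pmf.expectation Q (\<lambda>i. \<phi> (real i))"
proof -
  define d where "d = (\<lambda>i. pmf P i - pmf Q i)"
  define S where "S = {i. i \<le> n \<and> d i \<ge> 0}"
  have mass: "(\<Sum>i\<le>n. d i) = 0"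
    using expectation_eq_sum_atMost[OF P, of "\<lambda>_. 1"] expectation_eq_sum_atMost[OF Q, of "\<lambda>_. 1"]
    by (simp add: d_def sum_subtractf)
  have moment: "(\<Sum>i\<le>n. real i * d i) = 0"
    using mean expectation_eq_sum_atMost[OF P, of real] expectation_eq_sum_atMost[OF Q, of real]
    by (simp add: d_def sum_subtractf right_diff_distrib)
  have "S \<noteq> {}"
  proof
    assume "S = {}"
    then have "(\<Sum>i\<le>n. d i) < (\<Sum>i\<le>n. 0)"
      by (intro sum_strict_mono) (force simp: S_def)+
    with mass show False by simp
  qed
  moreover have "finite S"
    by (simp add: S_def)
  ultimately have in_S: "Min S \<in> S" "Max S \<in> S"
    and S_bounds: "\<And>i. i \<in> S \<Longrightarrow> Min S \<le> i \<and> i \<le> Max S"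
    by simp_all
  define a where "a = Min S"
  \<comment> \<open>If the interval of excess is a single point \<open>a\<close>, the chord from \<open>a\<close> to \<open>a + 1\<close> works
    as well: it agrees with \<open>\<phi>\<close> at \<open>a + 1\<close>, so the sign of \<open>d\<close> there is irrelevant.\<close>
  define b where "b = max (Max S) (a + 1)"
  define D where "D = (\<lambda>i. (real b - real a) * \<phi> (real i)
    - ((real b - real i) * \<phi> (real a) + (real i - real a) * \<phi> (real b)))"
  have ab: "a < b"
    by (simp add: b_def)
  have inside: "D i \<le> 0" if "a \<le> i" "i \<le> b" for i
    using convex_on_three_points[OF cvx, of "real a" "real i" "real b"] that by (simp add: D_def)
  have below: "D i \<ge> 0" if "i \<le> a" for i
    using convex_on_three_points[OF cvx, of "real i" "real a" "real b"] that ab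
    by (simp add: D_def algebra_simps)
  have above: "D i \<ge> 0" if "b \<le> i" for i
    using convex_on_three_points[OF cvx, of "real a" "real b" "real i"] that ab
    by (simp add: D_def algebra_simps)
  have sign: "D i * d i \<le> 0" if "i \<le> n" for i
  proof (cases "i \<in> S")
    case True
    then have "D i \<le> 0"
      using S_bounds[OF True] by (intro inside) (auto simp: a_def b_def)
    then show ?thesis
      using True by (simp add: S_def mult_nonpos_nonneg)
  next
    case False
    then have neg: "d i \<le> 0"
      using that by (simp add: S_def)
    have "\<not> (Min S \<le> i \<and> i \<le> Max S)"
      using interval[of "Min S" i "Max S"] in_S False that by (auto simp: S_def d_def)
    then have "i \<le> a \<or> b \<le> i"
      by (auto simp: a_def b_def)
    then have "D i \<ge> 0"
      using below above by blast
    then show ?thesis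
      using neg by (simp add: mult_nonneg_nonpos)
  qed
  have split: "D i * d i = (real b - real a) * (\<phi> (real i) * d i)
      - (real b * \<phi> (real a) - real a * \<phi> (real b)) * d i
      - (\<phi> (real b) - \<phi> (real a)) * (real i * d i)" for i
    by (simp add: D_def algebra_simps)
  have "(\<Sum>i\<le>n. D i * d i) = (real b - real a) * (\<Sum>i\<le>n. \<phi> (real i) * d i)"
    unfolding split sum_subtractf sum_distrib_left[symmetric] mass moment by simp
  then have "(real b - real a) * (\<Sum>i\<le>n. \<phi> (real i) * d i) \<le> 0"
    using sum_nonpos[of "{..n}" "\<lambda>i. D i * d i"] sign by simp
  then have "(\<Sum>i\<le>n. \<phi> (real i) * d i) \<le> 0"
    using ab by (simp add: mult_le_0_iff)
  then show ?thesis
    unfolding expectation_eq_sum_atMost[OF P] expectation_eq_sum_atMost[OF Q]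
    by (simp add: d_def sum_subtractf right_diff_distrib)
qed

section \<open>Moments of the binomial law\<close>

lemma expectation_binomial_eq_Bernstein:
  fixes f :: "nat \<Rightarrow> real"
  assumes "r \<in> {0..1}"
  shows "measure_pmf.expectation (binomial_pmf n r) f = (\<Sum>k\<le>n. f k * Bernstein n k r)"
  unfolding expectation_binomial_pmf'[OF assms] Bernstein_def by (simp add: mult_ac)

lemma expectation_binomial:
  assumes "r \<in> {0..1}"
  shows "measure_pmf.expectation (binomial_pmf n r) real = real n * r"
  by (simp add: expectation_binomial_eq_Bernstein[OF assms] sum_k_Bernstein)

lemma second_moment_binomial:
  assumes "r \<in> {0..1}"
  shows "measure_pmf.expectation (binomial_pmf n r) (\<lambda>i. (real i)\<^sup>2)
    = real n * r * (1 - r) + (real n * r)\<^sup>2"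
proof -
  have "(real k)\<^sup>2 * c = real k * (real k - 1) * c + real k * c" for k c
    by (simp add: power2_eq_square algebra_simps)
  then have "measure_pmf.expectation (binomial_pmf n r) (\<lambda>i. (real i)\<^sup>2)
      = (\<Sum>k\<le>n. real k * (real k - 1) * Bernstein n k r) + (\<Sum>k\<le>n. real k * Bernstein n k r)"
    by (simp add: expectation_binomial_eq_Bernstein[OF assms] sum.distrib)
  then show ?thesis
    unfolding sum_k_Bernstein sum_kk_Bernstein by (simp add: power2_eq_square algebra_simps)
qed

section \<open>Inverse differences\<close>

text \<open>This identifies an inverse difference without summing the series: it suffices to guess a
  primitive that is eventually zero.\<close>

lemma fdiff_inv_fdiff:
  assumes zero: "\<And>j. N \<le> j \<Longrightarrow> g j = 0"
  shows "fdiff_inv (fdiff g) = g"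
proof
  fix j
  have "(\<lambda>i. g (j + i)) \<longlonglongrightarrow> 0"
    by (rule tendsto_eventually) (auto intro!: eventually_sequentiallyI[of N] zero)
  from telescope_sums[OF this] show "fdiff_inv (fdiff g) j = g j"
    by (simp add: fdiff_inv_def fdiff_def sums_iff)
qed

lemma sup_norm_le:
  assumes "\<And>j. \<bar>f j\<bar> \<le> c"
  shows "sup_norm f \<le> ereal c"
  unfolding sup_norm_def using assms by (intro SUP_least) simp

section \<open>The comparison with the binomial law\<close>

theorem corollary4p6:
  fixes n :: nat and r :: real and W Z :: "nat pmf" and F G :: "nat \<Rightarrow> real" and k :: int
  assumes "n \<ge> 1"
    and "ULC n W"
    and "set_pmf W = {0..n}"
    and "measure_pmf.expectation W real = real n * r"
    and "real n * r > 0"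
    and "Z = binomial_pmf n r"
    and "F = dist_fun W"
    and "G = dist_fun Z"
    and "k \<in> {-1, 0, 1, 2}"
  shows "d_inf (- k) F G
    \<le> ereal (2 powi (max (- k) 0 - 1) * (real n * r * (1 - r) - measure_pmf.variance W real))"
proof -
  define V where "V = real n * r * (1 - r) - measure_pmf.variance W real"
  have W: "set_pmf W \<subseteq> {..n}"
    using assms(3) by auto
  have r0: "0 < r"
    using assms(1,5) by (simp add: zero_less_mult_iff)
  \<comment> \<open>The atom of \<open>W\<close> at 0 keeps its mean strictly below \<open>n\<close>.\<close>
  have r1: "r < 1"
  proof -
    have "0 < real n * pmf W 0"
      using assms(1,3) by (simp add: pmf_positive)
    also have "\<dots> = (\<Sum>i\<in>{0}. (real n - real i) * pmf W i)"
      by simp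
    also have "\<dots> \<le> (\<Sum>i\<le>n. (real n - real i) * pmf W i)"
      by (intro sum_mono2) auto
    also have "\<dots> = real n * (\<Sum>i\<le>n. 1 * pmf W i) - (\<Sum>i\<le>n. real i * pmf W i)"
      by (simp add: left_diff_distrib sum_subtractf sum_distrib_left)
    also have "\<dots> = real n - real n * r"
      unfolding expectation_eq_sum_atMost[OF W, symmetric] assms(4) by simp
    finally show ?thesis
      using assms(1) by simp
  qed
  have r: "r \<in> {0..1}"
    using r0 r1 by simp
  have Z: "set_pmf Z \<subseteq> {..n}"
    using assms(6) r0 r1 by simp
  have mean_Z: "measure_pmf.expectation Z real = real n * r"
    by (simp add: assms(6) expectation_binomial[OF r])
  have convex_order:
    "measure_pmf.expectation W (\<lambda>i. \<phi> (real i)) \<le> measure_pmf.expectation Z (\<lambda>i. \<phi> (real i))"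
    if "convex_on UNIV \<phi>" for \<phi>
  proof (rule expectation_convex_le_of_interval[OF W Z _ _ that])
    show "measure_pmf.expectation W real = measure_pmf.expectation Z real"
      by (simp add: assms(4) mean_Z)
    show "pmf W k \<ge> pmf Z k"
      if "i \<le> k" "k \<le> m" "m \<le> n" "pmf W i \<ge> pmf Z i" "pmf W m \<ge> pmf Z m" for i k m
      using ULC_ge_binomial_interval[OF assms(2,3) r0 r1] that unfolding assms(6) by blast
  qed
  define d where "d = (\<lambda>f. \<Sum>i\<le>n. f i * (pmf Z i - pmf W i))"
  have d_eq: "d f = measure_pmf.expectation Z f - measure_pmf.expectation W f" for f
    unfolding d_def expectation_eq_sum_atMost[OF W] expectation_eq_sum_atMost[OF Z]
    by (simp add: sum_subtractf right_diff_distrib)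
  have d_diff: "d f - d g = d (\<lambda>i. f i - g i)" for f g
    by (simp add: d_def sum_subtractf left_diff_distrib)
  \<comment> \<open>In both definitions the truncated subtraction is the positive part.\<close>
  define u where "u = (\<lambda>j. d (\<lambda>i. real (i - j)))"
  define w where "w = (\<lambda>j. d (\<lambda>i. real (Suc (i - j) choose 2)))"
  have u_nonneg: "u j \<ge> 0" for j
  proof -
    have "convex_on UNIV (\<lambda>x. max (x - real j) 0)"
      by (rule convex_on_positive_part)
    moreover have "max (real i - real j) 0 = real (i - j)" for i
      by simp
    ultimately show ?thesis
      using convex_order[of "\<lambda>x. max (x - real j) 0"] by (simp only: u_def d_eq) simp
  qed
  have u_zero: "u j = 0" and w_zero: "w j = 0" if "n \<le> j" for j
    using that by (simp_all add: u_def w_def d_def numeral_2_eq_2)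
  have fdiff_w: "fdiff w = (\<lambda>j. - u j)"
  proof
    fix j
    have "real (Suc (i - (j + 1)) choose 2) - real (Suc (i - j) choose 2) = - real (i - j)" for i
    proof (cases "i - j")
      case (Suc l)
      then have "i - (j + 1) = l"
        by simp
      with Suc show ?thesis
        by (simp add: numeral_2_eq_2)
    qed simp
    then show "fdiff w j = - u j"
      unfolding fdiff_def w_def u_def d_diff by (simp add: d_def sum_negf)
  qed
  have fdiff_u: "fdiff (\<lambda>j. - u j) = (\<lambda>j. F j - G j)"
  proof
    fix j
    have step: "real (i - j) - real (i - (j + 1)) = 1 - indicator {..j} i" for i
      by (auto simp: indicator_def)
    have "fdiff (\<lambda>j. - u j) j = u j - u (j + 1)"
      by (simp add: fdiff_def)
    also have "\<dots> = d (\<lambda>_. 1) - d (indicator {..j})"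
      unfolding u_def d_diff step by (rule refl)
    also have "\<dots> = F j - G j"
      by (simp add: d_eq assms(7,8) dist_fun_def)
    finally show "fdiff (\<lambda>j. - u j) j = F j - G j" .
  qed
  have inv1: "fdiff_inv (\<lambda>j. F j - G j) = (\<lambda>j. - u j)"
    using fdiff_inv_fdiff[of n "\<lambda>j. - u j"] u_zero by (simp add: fdiff_u)
  have inv2: "fdiff_inv (\<lambda>j. - u j) = w"
    using fdiff_inv_fdiff[of n w] w_zero by (simp add: fdiff_w)
  have w_step: "w j - w (Suc j) = u j" for j
    using fun_cong[OF fdiff_w, of j] by (simp add: fdiff_def)
  have w_dec: "decseq w"
    using u_nonneg w_step by (intro decseq_SucI) (metis diff_ge_0_iff_ge)
  have w_nonneg: "w j \<ge> 0" for j
    using decseqD[OF w_dec, of j "max j n"] w_zero[of "max j n"] by simp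
  have w0: "w 0 = V / 2"
  proof -
    have choose: "real (Suc i choose 2) = (real i)\<^sup>2 / 2 + real i / 2" for i
      by (induction i) (simp_all add: numeral_2_eq_2 power2_eq_square field_simps)
    have weight: "real (Suc i choose 2) * c = ((real i)\<^sup>2 * c + real i * c) / 2" for i c
      unfolding choose by (simp add: algebra_simps)
    have "w 0 = (d (\<lambda>i. (real i)\<^sup>2) + d real) / 2"
      unfolding w_def d_def diff_zero weight sum_divide_distrib[symmetric] sum.distrib ..
    also have "d real = 0"
      by (simp add: d_eq assms(4) mean_Z)
    also have "d (\<lambda>i. (real i)\<^sup>2) = V"
    proof -
      have "finite (set_pmf W)"
        using W finite_subset by blast
      then have "measure_pmf.variance W real
          = measure_pmf.expectation W (\<lambda>i. (real i)\<^sup>2) - (real n * r)\<^sup>2"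
        by (subst measure_pmf.variance_eq) (auto simp: integrable_measure_pmf_finite assms(4))
      then show ?thesis
        by (simp add: d_eq V_def assms(6) second_moment_binomial[OF r])
    qed
    finally show ?thesis by simp
  qed
  have w_le: "w j \<le> V / 2" for j
    using decseqD[OF w_dec, of 0 j] w0 by simp
  have u_le: "u j \<le> V / 2" for j
    using w_step[of j] w_nonneg[of "Suc j"] w_le[of j] by linarith
  have FG_le: "\<bar>F j - G j\<bar> \<le> V / 2" for j
  proof -
    have "F j - G j = u j - u (j + 1)"
      using fun_cong[OF fdiff_u, of j] by (simp add: fdiff_def)
    then show ?thesis
      using u_nonneg[of j] u_nonneg[of "j + 1"] u_le[of j] u_le[of "j + 1"] by linarith
  qed
  have "d_inf (- k) F G \<le> ereal (2 powi (max (- k) 0 - 1) * V)"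
    unfolding d_inf_def
  proof (rule sup_norm_le)
    fix j
    consider "k = -1" | "k = 0" | "k = 1" | "k = 2"
      using assms(9) by auto
    then show "\<bar>fdiff_pow (- k) (\<lambda>j. F j - G j) j\<bar> \<le> 2 powi (max (- k) 0 - 1) * V"
    proof cases
      case 1
      then show ?thesis
        using abs_triangle_ineq4[of "F (j + 1) - G (j + 1)" "F j - G j"]
          FG_le[of j] FG_le[of "j + 1"] by (simp add: fdiff_pow_def fdiff_def)
    next
      case 2
      then show ?thesis
        using FG_le[of j] by (simp add: fdiff_pow_def power_int_minus)
    next
      case 3
      then show ?thesis
        using u_nonneg[of j] u_le[of j] by (simp add: fdiff_pow_def inv1 power_int_minus)
    next
      case 4
      then show ?thesis
        using w_nonneg[of j] w_le[of j]
        by (simp add: fdiff_pow_def numeral_2_eq_2 inv1 inv2 power_int_minus)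
    qed
  qed
  then show ?thesis
    by (simp add: V_def)
qed

end
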